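(* For every prime $p$ there exists a minion homomorphism $\mathcal V_p\text{-}\mathbb Z_p\to\mathcal Z_{p^2}$.
   Context: A minion $\mathcal R$ is a functor from finite sets to sets: it assigns a set $\mathcal R^{(D)}$ to each finite set $D$ and a map $\mathcal R^{(\alpha)}:\mathcal R^{(D)}\to\mathcal R^{(E)}$ to each function $\alpha:D\to E$ between finite sets, preserving identities and composition. A minion homomorphism $\xi:\mathcal R\to\mathcal S$ is a natural transformation: a family of functions $\xi^{(D)}:\mathcal R^{(D)}\to\mathcal S^{(D)}$ with $\xi^{(E)}\circ\mathcal R^{(\alpha)}=\mathcal S^{(\alpha)}\circ\xi^{(D)}$ for every $\alpha:D\to E$. For $m\in\mathbb N$, the minion $\mathcal Z_m$ is given by $\mathcal Z_m^{(D)}=\{f:D\to\mathbb Z_m\mid\sum_{a\in D}f(a)=1\}$ (where $\mathbb Z_m$ is the ring of integers modulo $m$), and for $\alpha:D\to E$, $\mathcal Z_m^{(\alpha)}(f)(b)=\sum_{a\in\alpha^{-1}(b)}f(a)$. For a prime $p$ and $k\ge2$, the minion $\mathcal V_k\text{-}\mathbb Z_p$ is defined as follows; all computations are in the field $\mathbb Z_p$. For vectors in $\mathbb Z_p^N$ let $\mathfrak w(v_1,\dots,v_N)=v_1+\cdots+v_N$ and let $\odot$ denote the componentwise product. For a finite set $D$, $(\mathcal V_k\text{-}\mathbb Z_p)^{(D)}$ is the set of triples $(V,\mathbf i,\mathbf v)$ where $V$ is a linear subspace of $\mathbb Z_p^N$ for some $N\in\mathbb N$, $\mathbf i\in V$,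 and $\mathbf v:D\to V$, such that: (i) $\mathbf i=(1,1,\dots,1)$ and $\mathfrak w(\mathbf i)=1$; (s) $\sum_{a\in D}\mathbf v(a)=\mathbf i$; (o) $\mathfrak w(\mathbf v(a)\odot\mathbf v(b)\odot\mathbf u_1\odot\cdots\odot\mathbf u_{k-2})=0$ for all $a\ne b$ in $D$ and all $\mathbf u_1,\dots,\mathbf u_{k-2}\in V$; (p) $\mathfrak w(\mathbf v(a)\odot\mathbf v(a)\odot\mathbf u_1\odot\cdots\odot\mathbf u_{k-2})=\mathfrak w(\mathbf v(a)\odot\mathbf u_1\odot\cdots\odot\mathbf u_{k-2})$ for all $a\in D$ and all $\mathbf u_1,\dots,\mathbf u_{k-2}\in V$. For $\alpha:D\to E$, $(\mathcal V_k\text{-}\mathbb Z_p)^{(\alpha)}(V,\mathbf i,\mathbf v)=(V,\mathbf i,\mathbf v')$ with $\mathbf v'(b)=\sum_{a\in\alpha^{-1}(b)}\mathbf v(a)$. The claim concerns the case $k=p$. *)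

theory Defs
  imports "HOL-Number_Theory.Residues"
begin

section \<open>Minions\<close>

text \<open>
  The finite sets are the finite sets over a type \<open>'a\<close>, which is left arbitrary. A function
  \<open>D \<rightarrow> E\<close> is an element of \<open>D \<rightarrow>\<^sub>E E\<close>, so that equality of functions is equality in HOL;
  \<open>mmap R D E \<alpha>\<close> is the map \<open>R\<^sup>(\<^sup>\<alpha>\<^sup>)\<close> from \<open>mobj R D\<close> to \<open>mobj R E\<close>, and its values
  outside \<open>mobj R D\<close> are irrelevant.
\<close>

record ('a, 'r) minion =
  mobj :: "'a set \<Rightarrow> 'r set"
  mmap :: "'a set \<Rightarrow> 'a set \<Rightarrow> ('a \<Rightarrow> 'a) \<Rightarrow> 'r \<Rightarrow> 'r"

locale minion =
  fixes R :: "('a, 'r) minion"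
  assumes mmap_closed:
      "\<lbrakk>finite D; finite E; \<alpha> \<in> D \<rightarrow>\<^sub>E E; x \<in> mobj R D\<rbrakk> \<Longrightarrow> mmap R D E \<alpha> x \<in> mobj R E"
    and mmap_id:
      "\<lbrakk>finite D; x \<in> mobj R D\<rbrakk> \<Longrightarrow> mmap R D D (\<lambda>a\<in>D. a) x = x"
    and mmap_comp:
      "\<lbrakk>finite D; finite E; finite F; \<alpha> \<in> D \<rightarrow>\<^sub>E E; \<beta> \<in> E \<rightarrow>\<^sub>E F; x \<in> mobj R D\<rbrakk> \<Longrightarrow>
        mmap R D F (compose D \<beta> \<alpha>) x = mmap R E F \<beta> (mmap R D E \<alpha> x)"

locale minion_hom = R: minion R + S: minion S
  for R :: "('a, 'r) minion" and S :: "('a, 's) minion" +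
  fixes \<xi> :: "'a set \<Rightarrow> 'r \<Rightarrow> 's"
  assumes hom_closed: "\<lbrakk>finite D; x \<in> mobj R D\<rbrakk> \<Longrightarrow> \<xi> D x \<in> mobj S D"
    and natural:
      "\<lbrakk>finite D; finite E; \<alpha> \<in> D \<rightarrow>\<^sub>E E; x \<in> mobj R D\<rbrakk> \<Longrightarrow>
        \<xi> E (mmap R D E \<alpha> x) = mmap S D E \<alpha> (\<xi> D x)"


section \<open>The minion \<open>\<Z>\<^sub>m\<close>\<close>

text \<open>
  The unit is written \<open>1 mod m\<close> because \<^term>\<open>\<one>\<^bsub>residue_ring 1\<^esub>\<close> is \<open>1\<close>, which lies outside the
  carrier \<open>{0}\<close>; for \<open>m > 1\<close> it is \<^term>\<open>\<one>\<^bsub>residue_ring m\<^esub>\<close>.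
\<close>

definition Z_minion :: "nat \<Rightarrow> ('a, 'a \<Rightarrow> int) minion" where
  "Z_minion m =
    \<lparr>mobj = (\<lambda>D. {f \<in> D \<rightarrow>\<^sub>E carrier (residue_ring (int m)).
                   (\<Oplus>\<^bsub>residue_ring (int m)\<^esub> a\<in>D. f a) = 1 mod int m}),
     mmap = (\<lambda>D E \<alpha> f. \<lambda>b\<in>E. \<Oplus>\<^bsub>residue_ring (int m)\<^esub> a\<in>\<alpha> -` {b} \<inter> D. f a)\<rparr>"


section \<open>The minion \<open>\<V>\<^sub>k\<close>-\<open>\<Z>\<^sub>p\<close>\<close>

text \<open>
  \<open>R\<^sup>N\<close> with coordinates indexed by \<open>{..<N}\<close>, as an algebra over \<open>R\<close>: the ring multiplication
  \<open>\<otimes>\<close> is the componentwise product, whereas the library's \<open>\<odot>\<close> is scalar multiplication.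
\<close>

definition coord_space :: "('b, 'm) ring_scheme \<Rightarrow> nat \<Rightarrow> ('b, nat \<Rightarrow> 'b) module" where
  "coord_space R N =
    \<lparr>carrier = {..<N} \<rightarrow>\<^sub>E carrier R,
     monoid.mult = (\<lambda>u v. \<lambda>j\<in>{..<N}. u j \<otimes>\<^bsub>R\<^esub> v j),
     one = (\<lambda>j\<in>{..<N}. \<one>\<^bsub>R\<^esub>),
     zero = (\<lambda>j\<in>{..<N}. \<zero>\<^bsub>R\<^esub>),
     add = (\<lambda>u v. \<lambda>j\<in>{..<N}. u j \<oplus>\<^bsub>R\<^esub> v j),
     smult = (\<lambda>c u. \<lambda>j\<in>{..<N}. c \<otimes>\<^bsub>R\<^esub> u j)\<rparr>"

definition weight :: "('b, 'm) ring_scheme \<Rightarrow> nat \<Rightarrow> (nat \<Rightarrow> 'b) \<Rightarrow> 'b" where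
  "weight R N v = (\<Oplus>\<^bsub>R\<^esub> j\<in>{..<N}. v j)"

text \<open>
  A triple \<open>(V, i, v)\<close> is encoded as \<open>(N, V, i, v)\<close>. The dimension \<open>N\<close> of the ambient space is
  determined by \<open>V\<close> and is recorded only so that sums of vectors can be formed in
  \<^term>\<open>coord_space R N\<close>. A linear subspace is a submodule over the field \<open>\<Z>\<^sub>p\<close>.
\<close>

type_synonym 'a vel = "nat \<times> (nat \<Rightarrow> int) set \<times> (nat \<Rightarrow> int) \<times> ('a \<Rightarrow> nat \<Rightarrow> int)"

definition V_mobj :: "nat \<Rightarrow> nat \<Rightarrow> 'a set \<Rightarrow> 'a vel set" where
  "V_mobj k p D =
    (let R = residue_ring (int p) in
     {(N, V, i, v). let M = coord_space R N in
        submodule V R M \<and> i \<in> V \<and> v \<in> D \<rightarrow>\<^sub>E V \<and>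
        i = \<one>\<^bsub>M\<^esub> \<and> weight R N i = \<one>\<^bsub>R\<^esub> \<and>
        (\<Oplus>\<^bsub>M\<^esub> a\<in>D. v a) = i \<and>
        (\<forall>a\<in>D. \<forall>b\<in>D. a \<noteq> b \<longrightarrow> (\<forall>u \<in> {..<k-2} \<rightarrow> V.
           weight R N (v a \<otimes>\<^bsub>M\<^esub> v b \<otimes>\<^bsub>M\<^esub> (\<Otimes>\<^bsub>M\<^esub> l\<in>{..<k-2}. u l)) = \<zero>\<^bsub>R\<^esub>)) \<and>
        (\<forall>a\<in>D. \<forall>u \<in> {..<k-2} \<rightarrow> V.
           weight R N (v a \<otimes>\<^bsub>M\<^esub> v a \<otimes>\<^bsub>M\<^esub> (\<Otimes>\<^bsub>M\<^esub> l\<in>{..<k-2}. u l)) =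
           weight R N (v a \<otimes>\<^bsub>M\<^esub> (\<Otimes>\<^bsub>M\<^esub> l\<in>{..<k-2}. u l)))})"

definition V_mmap :: "nat \<Rightarrow> 'a set \<Rightarrow> 'a set \<Rightarrow> ('a \<Rightarrow> 'a) \<Rightarrow> 'a vel \<Rightarrow> 'a vel" where
  "V_mmap p D E \<alpha> =
    (\<lambda>(N, V, i, v).
      (N, V, i, \<lambda>b\<in>E. \<Oplus>\<^bsub>coord_space (residue_ring (int p)) N\<^esub> a\<in>\<alpha> -` {b} \<inter> D. v a))"

definition V_minion :: "nat \<Rightarrow> nat \<Rightarrow> ('a, 'a vel) minion" where
  "V_minion k p = \<lparr>mobj = V_mobj k p, mmap = V_mmap p\<rparr>"


section \<open>Well-definedness\<close>

lemma coord_space_simps: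
  "carrier (coord_space R N) = {..<N} \<rightarrow>\<^sub>E carrier R"
  "u \<otimes>\<^bsub>coord_space R N\<^esub> v = (\<lambda>j\<in>{..<N}. u j \<otimes>\<^bsub>R\<^esub> v j)"
  "\<one>\<^bsub>coord_space R N\<^esub> = (\<lambda>j\<in>{..<N}. \<one>\<^bsub>R\<^esub>)"
  "\<zero>\<^bsub>coord_space R N\<^esub> = (\<lambda>j\<in>{..<N}. \<zero>\<^bsub>R\<^esub>)"
  "u \<oplus>\<^bsub>coord_space R N\<^esub> v = (\<lambda>j\<in>{..<N}. u j \<oplus>\<^bsub>R\<^esub> v j)"
  "c \<odot>\<^bsub>coord_space R N\<^esub> u = (\<lambda>j\<in>{..<N}. c \<otimes>\<^bsub>R\<^esub> u j)"
  by (simp_all add: coord_space_def)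

lemma algebra_coord_space:
  assumes "cring R"
  shows "algebra R (coord_space R N)"
proof -
  interpret R: cring R by fact
  let ?M = "coord_space R N"
  note simps = coord_space_simps PiE_iff restrict_def fun_eq_iff extensional_def
  have ab: "abelian_group ?M"
  proof (rule abelian_groupI)
    fix x assume x: "x \<in> carrier ?M"
    show "\<exists>y\<in>carrier ?M. y \<oplus>\<^bsub>?M\<^esub> x = \<zero>\<^bsub>?M\<^esub>"
      by (rule bexI[of _ "\<lambda>j\<in>{..<N}. \<ominus>\<^bsub>R\<^esub> x j"]) (use x in \<open>simp_all add: simps R.l_neg\<close>)
  qed (simp_all add: simps R.a_ac)
  have cm: "comm_monoid ?M"
    by (rule comm_monoidI) (simp_all add: simps R.m_ac)
  have cr: "cring ?M"
    by (rule cringI[OF ab cm]) (simp_all add: simps R.l_distr)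
  show ?thesis
    by (rule algebraI[OF assms cr]) (simp_all add: simps R.l_distr R.r_distr R.m_assoc)
qed

lemma (in abelian_monoid) finsum_fibres:
  assumes "finite D" "finite E" "\<alpha> \<in> D \<rightarrow> E" "f \<in> D \<rightarrow> carrier G"
  shows "(\<Oplus>b\<in>E. \<Oplus>a\<in>\<alpha> -` {b} \<inter> D. f a) = (\<Oplus>a\<in>D. f a)"
proof -
  have "(\<Oplus>a\<in>(\<Union>b\<in>E. \<alpha> -` {b} \<inter> D). f a) = (\<Oplus>b\<in>E. \<Oplus>a\<in>\<alpha> -` {b} \<inter> D. f a)"
    by (rule add.finprod_UN_disjoint) (use assms in \<open>auto simp: pairwise_def disjnt_def\<close>)
  moreover have "(\<Union>b\<in>E. \<alpha> -` {b} \<inter> D) = D"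
    using assms(3) by auto
  ultimately show ?thesis by simp
qed

lemma (in abelian_monoid) finsum_fibres_comp:
  assumes "finite D" "finite E" "\<alpha> \<in> D \<rightarrow> E" "f \<in> D \<rightarrow> carrier G"
  shows "(\<Oplus>a\<in>compose D \<beta> \<alpha> -` {c} \<inter> D. f a) =
         (\<Oplus>b\<in>\<beta> -` {c} \<inter> E. \<Oplus>a\<in>\<alpha> -` {b} \<inter> D. f a)"
proof -
  let ?D = "compose D \<beta> \<alpha> -` {c} \<inter> D" and ?E = "\<beta> -` {c} \<inter> E"
  have "(\<Oplus>a\<in>?D. f a) = (\<Oplus>b\<in>?E. \<Oplus>a\<in>\<alpha> -` {b} \<inter> ?D. f a)"
    by (rule finsum_fibres[symmetric]) (use assms in \<open>auto simp: compose_eq\<close>)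
  also have "\<dots> = (\<Oplus>b\<in>?E. \<Oplus>a\<in>\<alpha> -` {b} \<inter> D. f a)"
  proof (rule finsum_cong')
    fix b assume "b \<in> ?E"
    then have "\<alpha> -` {b} \<inter> ?D = \<alpha> -` {b} \<inter> D"
      by (auto simp: compose_eq)
    then show "(\<Oplus>a\<in>\<alpha> -` {b} \<inter> ?D. f a) = (\<Oplus>a\<in>\<alpha> -` {b} \<inter> D. f a)" by simp
  qed (use assms in \<open>auto intro!: finsum_closed\<close>)
  finally show ?thesis .
qed

lemma (in abelian_monoid) finsum_fibre_id:
  assumes "f \<in> D \<rightarrow> carrier G" "b \<in> D"
  shows "(\<Oplus>a\<in>(\<lambda>a\<in>D. a) -` {b} \<inter> D. f a) = f b"
proof -
  have "(\<lambda>a\<in>D. a) -` {b} \<inter> D = {b}" using assms by auto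
  then show ?thesis using assms by (auto simp: Pi_def)
qed

lemma minion_Z_minion:
  assumes "m > 1"
  shows "minion (Z_minion m)"
proof -
  interpret residues "int m" "residue_ring (int m)"
    by unfold_locales (use assms in auto)
  have in_Pi: "f \<in> D \<rightarrow> carrier (residue_ring (int m))"
    if "f \<in> D \<rightarrow>\<^sub>E carrier (residue_ring (int m))" for f :: "'b \<Rightarrow> int" and D
    using that by (simp add: PiE_def)
  show ?thesis
  proof (unfold_locales, goal_cases)
    case (1 D E \<alpha> f)
    then show ?case
      by (auto simp: Z_minion_def finsum_fibres[of D E \<alpha> f] PiE_iff intro!: finsum_closed
               cong: finsum_cong)
  next
    case (2 D f)
    then show ?case
      by (auto simp: Z_minion_def fun_eq_iff PiE_iff extensional_def finsum_fibre_id)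
  next
    case (3 D E F \<alpha> \<beta> f)
    then have f: "f \<in> D \<rightarrow> carrier (residue_ring (int m))" and \<alpha>: "\<alpha> \<in> D \<rightarrow> E"
      by (auto simp: Z_minion_def PiE_iff)
    show ?case
      unfolding Z_minion_def minion.simps
    proof (rule restrict_ext)
      fix c assume "c \<in> F"
      show "(\<Oplus>\<^bsub>residue_ring (int m)\<^esub>a\<in>compose D \<beta> \<alpha> -` {c} \<inter> D. f a) =
        (\<Oplus>\<^bsub>residue_ring (int m)\<^esub>a\<in>\<beta> -` {c} \<inter> E.
          (\<lambda>b\<in>E. \<Oplus>\<^bsub>residue_ring (int m)\<^esub>a\<in>\<alpha> -` {b} \<inter> D. f a) a)"
        by (subst finsum_fibres_comp[OF 3(1,2) \<alpha> f], rule finsum_cong')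
           (use f in \<open>auto intro!: finsum_closed\<close>)
    qed
  qed
qed

lemma (in cring) weight_closed:
  "u \<in> carrier (coord_space R N) \<Longrightarrow> weight R N u \<in> carrier R"
  by (auto simp: weight_def coord_space_simps PiE_iff intro!: finsum_closed)

lemma (in cring) weight_zero: "weight R N \<zero>\<^bsub>coord_space R N\<^esub> = \<zero>"
  by (auto simp: weight_def coord_space_simps intro!: add.finprod_one_eqI)

lemma (in cring) weight_add:
  assumes "u \<in> carrier (coord_space R N)" "v \<in> carrier (coord_space R N)"
  shows "weight R N (u \<oplus>\<^bsub>coord_space R N\<^esub> v) = weight R N u \<oplus> weight R N v"
proof -
  have "weight R N (u \<oplus>\<^bsub>coord_space R N\<^esub> v) = (\<Oplus>j\<in>{..<N}. u j \<oplus> v j)"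
    unfolding weight_def using assms
    by (intro finsum_cong') (auto simp: coord_space_simps PiE_iff)
  also have "\<dots> = weight R N u \<oplus> weight R N v"
    unfolding weight_def using assms
    by (intro finsum_addf) (auto simp: coord_space_simps PiE_iff)
  finally show ?thesis .
qed

lemma (in cring) weight_finsum:
  assumes "finite A" "f \<in> A \<rightarrow> carrier (coord_space R N)"
  shows "weight R N (\<Oplus>\<^bsub>coord_space R N\<^esub> a\<in>A. f a) = (\<Oplus>a\<in>A. weight R N (f a))"
proof -
  interpret M: algebra R "coord_space R N"
    by (rule algebra_coord_space) unfold_locales
  show ?thesis
    using assms
  proof (induction A)
    case empty
    then show ?case by (simp add: weight_zero)
  next
    case (insert x A)
    then have "weight R N (f x) \<in> carrier R" "(\<lambda>a. weight R N (f a)) \<in> A \<rightarrow> carrier R"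
      by (auto intro!: weight_closed)
    with insert show ?case
      by (simp add: weight_add M.finsum_closed Pi_def)
  qed
qed

lemma (in abelian_monoid) finsum_mem_subgroup:
  assumes "subgroup V (add_monoid G)" "f \<in> A \<rightarrow> V" "finite A"
  shows "(\<Oplus>a\<in>A. f a) \<in> V"
  using assms(3,2)
proof (induction A)
  case empty
  then show ?case using subgroup.one_closed[OF assms(1)] by simp
next
  case (insert x A)
  have "V \<subseteq> carrier G" using subgroup.subset[OF assms(1)] by simp
  with insert subgroup.m_closed[OF assms(1), of "f x" "\<Oplus>a\<in>A. f a"] show ?case
    by (auto simp: Pi_def subset_iff finsum_insert)
qed

lemma (in cring) finsum_mult_finsum:
  assumes "finite A" "finite B" "f \<in> A \<rightarrow> carrier R" "g \<in> B \<rightarrow> carrier R" "w \<in> carrier R"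
  shows "(\<Oplus>a\<in>A. f a) \<otimes> (\<Oplus>b\<in>B. g b) \<otimes> w = (\<Oplus>a\<in>A. \<Oplus>b\<in>B. f a \<otimes> g b \<otimes> w)"
proof -
  have "(\<Oplus>a\<in>A. f a) \<otimes> (\<Oplus>b\<in>B. g b) \<otimes> w = (\<Oplus>a\<in>A. f a \<otimes> (\<Oplus>b\<in>B. g b) \<otimes> w)"
    using assms by (simp add: finsum_ldistr finsum_closed Pi_def)
  also have "\<dots> = (\<Oplus>a\<in>A. \<Oplus>b\<in>B. f a \<otimes> g b \<otimes> w)"
  proof (rule finsum_cong')
    fix a assume "a \<in> A"
    then have "f a \<in> carrier R" using assms by auto
    then show "f a \<otimes> (\<Oplus>b\<in>B. g b) \<otimes> w = (\<Oplus>b\<in>B. f a \<otimes> g b \<otimes> w)"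
      using assms by (simp add: finsum_rdistr finsum_ldistr finsum_closed Pi_def)
  qed (use assms in \<open>auto intro!: finsum_closed simp: Pi_def\<close>)
  finally show ?thesis .
qed

lemma minion_V_minion:
  assumes "p > 1"
  shows "minion (V_minion k p)"
proof -
  define R where "R = residue_ring (int p)"
  interpret residues "int p" R
    by (unfold_locales) (use assms in \<open>auto simp: R_def\<close>)
  note defs = V_minion_def V_mobj_def V_mmap_def Let_def R_def[symmetric]
  show ?thesis
  proof (unfold_locales, goal_cases)
    case (1 D E \<alpha> x)
    obtain N V i v where x: "x = (N, V, i, v)" by (metis prod_cases4)
    let ?M = "coord_space R N"
    interpret M: algebra R ?M by (rule algebra_coord_space) unfold_locales
    from 1(4) x have sub: "submodule V R ?M" and iV: "i \<in> V" and v: "v \<in> D \<rightarrow>\<^sub>E V"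
      and i1: "i = \<one>\<^bsub>?M\<^esub>" and w1: "weight R N i = \<one>\<^bsub>R\<^esub>" and s: "(\<Oplus>\<^bsub>?M\<^esub> a\<in>D. v a) = i"
      and o: "\<And>a b u. a \<in> D \<Longrightarrow> b \<in> D \<Longrightarrow> a \<noteq> b \<Longrightarrow> u \<in> {..<k-2} \<rightarrow> V \<Longrightarrow>
           weight R N (v a \<otimes>\<^bsub>?M\<^esub> v b \<otimes>\<^bsub>?M\<^esub> (\<Otimes>\<^bsub>?M\<^esub> l\<in>{..<k-2}. u l)) = \<zero>\<^bsub>R\<^esub>"
      and q: "\<And>a u. a \<in> D \<Longrightarrow> u \<in> {..<k-2} \<rightarrow> V \<Longrightarrow>
           weight R N (v a \<otimes>\<^bsub>?M\<^esub> v a \<otimes>\<^bsub>?M\<^esub> (\<Otimes>\<^bsub>?M\<^esub> l\<in>{..<k-2}. u l)) =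
           weight R N (v a \<otimes>\<^bsub>?M\<^esub> (\<Otimes>\<^bsub>?M\<^esub> l\<in>{..<k-2}. u l))"
      by (auto simp: defs)
    have subg: "subgroup V (add_monoid ?M)" using sub by (rule submodule.axioms)
    have VM: "V \<subseteq> carrier ?M" using subgroup.subset[OF subg] by simp
    have vV: "v a \<in> V" "v a \<in> carrier ?M" if "a \<in> D" for a
      using v VM that by (auto simp: PiE_iff)
    let ?F = "\<lambda>b. \<alpha> -` {b} \<inter> D"
    have F: "finite (?F b)" "\<And>a. a \<in> ?F b \<Longrightarrow> a \<in> D" for b using 1(1) by auto
    define v' where "v' = (\<lambda>b\<in>E. \<Oplus>\<^bsub>?M\<^esub> a\<in>?F b. v a)"
    have v': "v' \<in> E \<rightarrow>\<^sub>E V"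
      unfolding v'_def by (auto intro!: M.finsum_mem_subgroup[OF subg] vV F(1))
    have v'_eq: "v' b = (\<Oplus>\<^bsub>?M\<^esub> a\<in>?F b. v a)" if "b \<in> E" for b
      using that by (simp add: v'_def)
    have U: "(\<Otimes>\<^bsub>?M\<^esub> l\<in>{..<k-2}. u l) \<in> carrier ?M" if "u \<in> {..<k-2} \<rightarrow> V" for u
      using that VM by (intro M.finprod_closed) auto
    have sum': "(\<Oplus>\<^bsub>?M\<^esub> b\<in>E. v' b) = i"
    proof -
      have "(\<Oplus>\<^bsub>?M\<^esub> b\<in>E. v' b) = (\<Oplus>\<^bsub>?M\<^esub> b\<in>E. \<Oplus>\<^bsub>?M\<^esub> a\<in>?F b. v a)"
        by (rule M.finsum_cong') (auto simp: v'_eq vV intro!: M.finsum_closed)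
      also have "\<dots> = i"
        using 1(1-3) by (subst M.finsum_fibres) (auto simp: vV s PiE_iff)
      finally show ?thesis .
    qed
    have two: "weight R N (v' b \<otimes>\<^bsub>?M\<^esub> v' c \<otimes>\<^bsub>?M\<^esub> w) =
        (\<Oplus>\<^bsub>R\<^esub>a\<in>?F b. \<Oplus>\<^bsub>R\<^esub>a'\<in>?F c. weight R N (v a \<otimes>\<^bsub>?M\<^esub> v a' \<otimes>\<^bsub>?M\<^esub> w))"
      if "b \<in> E" "c \<in> E" "w \<in> carrier ?M" for b c w
    proof -
      have "v' b \<otimes>\<^bsub>?M\<^esub> v' c \<otimes>\<^bsub>?M\<^esub> w =
          (\<Oplus>\<^bsub>?M\<^esub>a\<in>?F b. \<Oplus>\<^bsub>?M\<^esub>a'\<in>?F c. v a \<otimes>\<^bsub>?M\<^esub> v a' \<otimes>\<^bsub>?M\<^esub> w)"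
        unfolding v'_eq[OF that(1)] v'_eq[OF that(2)]
        by (rule M.finsum_mult_finsum) (use F(1) vV that in auto)
      then have "weight R N (v' b \<otimes>\<^bsub>?M\<^esub> v' c \<otimes>\<^bsub>?M\<^esub> w) =
          weight R N (\<Oplus>\<^bsub>?M\<^esub>a\<in>?F b. \<Oplus>\<^bsub>?M\<^esub>a'\<in>?F c. v a \<otimes>\<^bsub>?M\<^esub> v a' \<otimes>\<^bsub>?M\<^esub> w)"
        by (rule arg_cong)
      also have "\<dots> =
          (\<Oplus>\<^bsub>R\<^esub>a\<in>?F b. weight R N (\<Oplus>\<^bsub>?M\<^esub>a'\<in>?F c. v a \<otimes>\<^bsub>?M\<^esub> v a' \<otimes>\<^bsub>?M\<^esub> w))"
        by (rule weight_finsum[OF F(1)], intro Pi_I M.finsum_closed M.m_closed; use vV that in blast)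
      also have "\<dots> = (\<Oplus>\<^bsub>R\<^esub>a\<in>?F b. \<Oplus>\<^bsub>R\<^esub>a'\<in>?F c. weight R N (v a \<otimes>\<^bsub>?M\<^esub> v a' \<otimes>\<^bsub>?M\<^esub> w))"
      proof (rule finsum_cong'[OF refl])
        fix a assume a: "a \<in> ?F b"
        show "weight R N (\<Oplus>\<^bsub>?M\<^esub>a'\<in>?F c. v a \<otimes>\<^bsub>?M\<^esub> v a' \<otimes>\<^bsub>?M\<^esub> w) =
            (\<Oplus>\<^bsub>R\<^esub>a'\<in>?F c. weight R N (v a \<otimes>\<^bsub>?M\<^esub> v a' \<otimes>\<^bsub>?M\<^esub> w))"
          by (rule weight_finsum) (use F(1) vV that a in auto)
      qed (intro Pi_I finsum_closed weight_closed M.m_closed; use vV that in blast)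
      finally show ?thesis .
    qed
    have o': "weight R N (v' b \<otimes>\<^bsub>?M\<^esub> v' c \<otimes>\<^bsub>?M\<^esub> (\<Otimes>\<^bsub>?M\<^esub> l\<in>{..<k-2}. u l)) = \<zero>\<^bsub>R\<^esub>"
      if "b \<in> E" "c \<in> E" "b \<noteq> c" "u \<in> {..<k-2} \<rightarrow> V" for b c u
      unfolding two[OF that(1,2) U[OF that(4)]]
      by (intro add.finprod_one_eqI) (use that in \<open>auto intro!: o\<close>)
    have q': "weight R N (v' b \<otimes>\<^bsub>?M\<^esub> v' b \<otimes>\<^bsub>?M\<^esub> (\<Otimes>\<^bsub>?M\<^esub> l\<in>{..<k-2}. u l)) =
        weight R N (v' b \<otimes>\<^bsub>?M\<^esub> (\<Otimes>\<^bsub>?M\<^esub> l\<in>{..<k-2}. u l))"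
      if b: "b \<in> E" and u: "u \<in> {..<k-2} \<rightarrow> V" for b u
    proof -
      let ?U = "\<Otimes>\<^bsub>?M\<^esub> l\<in>{..<k-2}. u l"
      have "(\<Oplus>\<^bsub>R\<^esub>a'\<in>?F b. weight R N (v a \<otimes>\<^bsub>?M\<^esub> v a' \<otimes>\<^bsub>?M\<^esub> ?U)) = weight R N (v a \<otimes>\<^bsub>?M\<^esub> ?U)"
        if a: "a \<in> ?F b" for a
      proof -
        have "(\<Oplus>\<^bsub>R\<^esub>a'\<in>?F b. weight R N (v a \<otimes>\<^bsub>?M\<^esub> v a' \<otimes>\<^bsub>?M\<^esub> ?U)) =
          (\<Oplus>\<^bsub>R\<^esub>a'\<in>?F b. if a = a' then weight R N (v a' \<otimes>\<^bsub>?M\<^esub> ?U) else \<zero>\<^bsub>R\<^esub>)"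
          by (rule finsum_cong')
             (use a u U[OF u] vV in \<open>auto intro!: o q weight_closed\<close>)
        also have "\<dots> = weight R N (v a \<otimes>\<^bsub>?M\<^esub> ?U)"
          by (rule finsum_singleton[OF a F(1)]) (use U[OF u] vV in \<open>auto intro!: weight_closed\<close>)
        finally show ?thesis .
      qed
      then have "weight R N (v' b \<otimes>\<^bsub>?M\<^esub> v' b \<otimes>\<^bsub>?M\<^esub> ?U) = (\<Oplus>\<^bsub>R\<^esub>a\<in>?F b. weight R N (v a \<otimes>\<^bsub>?M\<^esub> ?U))"
        unfolding two[OF b b U[OF u]]
        by (intro finsum_cong') (use U[OF u] vV in \<open>auto intro!: weight_closed\<close>)
      also have "\<dots> = weight R N (\<Oplus>\<^bsub>?M\<^esub>a\<in>?F b. v a \<otimes>\<^bsub>?M\<^esub> ?U)"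
        by (rule weight_finsum[symmetric]) (use F(1) U[OF u] vV in auto)
      also have "(\<Oplus>\<^bsub>?M\<^esub>a\<in>?F b. v a \<otimes>\<^bsub>?M\<^esub> ?U) = v' b \<otimes>\<^bsub>?M\<^esub> ?U"
        unfolding v'_eq[OF b]
        by (rule M.finsum_ldistr[symmetric]) (use F(1) U[OF u] vV in auto)
      finally show ?thesis .
    qed
    have "(N, V, i, v') \<in> V_mobj k p E"
      using sub iV v' i1 w1 sum' o' q' by (simp add: defs)
    then show ?case by (simp add: x V_minion_def V_mmap_def v'_def R_def)
  next
    case (2 D x)
    obtain N V i v where x: "x = (N, V, i, v)" by (metis prod_cases4)
    let ?M = "coord_space R N"
    interpret M: algebra R ?M by (rule algebra_coord_space) unfold_locales
    from 2 x have sub: "submodule V R ?M" and v: "v \<in> D \<rightarrow>\<^sub>E V"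
      by (auto simp: defs)
    have "V \<subseteq> carrier ?M" using subgroup.subset[OF submodule.axioms(1)[OF sub]] by simp
    with v have vM: "v \<in> D \<rightarrow> carrier ?M" by (auto simp: PiE_iff)
    have "(\<lambda>b\<in>D. \<Oplus>\<^bsub>?M\<^esub>a\<in>(\<lambda>a\<in>D. a) -` {b} \<inter> D. v a) = v"
    proof (rule ext)
      fix b
      show "(\<lambda>b\<in>D. \<Oplus>\<^bsub>?M\<^esub>a\<in>(\<lambda>a\<in>D. a) -` {b} \<inter> D. v a) b = v b"
        using M.finsum_fibre_id[OF vM, of b] PiE_arb[OF v, of b] by (cases "b \<in> D") simp_all
    qed
    then show ?case by (simp add: x V_minion_def V_mmap_def R_def)
  next
    case (3 D E F \<alpha> \<beta> x)
    obtain N V i v where x: "x = (N, V, i, v)" by (metis prod_cases4)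
    let ?M = "coord_space R N"
    interpret M: algebra R ?M by (rule algebra_coord_space) unfold_locales
    from 3 x have sub: "submodule V R ?M" and v: "v \<in> D \<rightarrow>\<^sub>E V"
      by (auto simp: defs)
    have "V \<subseteq> carrier ?M" using subgroup.subset[OF submodule.axioms(1)[OF sub]] by simp
    with v have v: "v \<in> D \<rightarrow> carrier ?M" by (auto simp: PiE_iff)
    have \<alpha>: "\<alpha> \<in> D \<rightarrow> E" using 3 by (auto simp: PiE_iff)
    have "(\<Oplus>\<^bsub>?M\<^esub>a\<in>compose D \<beta> \<alpha> -` {c} \<inter> D. v a) =
        (\<Oplus>\<^bsub>?M\<^esub>a\<in>\<beta> -` {c} \<inter> E. (\<lambda>b\<in>E. \<Oplus>\<^bsub>?M\<^esub>a\<in>\<alpha> -` {b} \<inter> D. v a) a)" for c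
      by (subst M.finsum_fibres_comp[OF 3(1,2) \<alpha> v], rule M.finsum_cong')
         (use v in \<open>auto intro!: M.finsum_closed\<close>)
    then show ?case
      by (simp only: x V_minion_def V_mmap_def minion.simps prod.case R_def)
  qed
qed

end

theory Submission
  imports Defs
begin

text \<open>
  If \<open>x\<close> is an integer, then \<open>x\<^sup>p\<close> modulo \<open>p\<^sup>2\<close> depends only on \<open>x\<close> modulo \<open>p\<close>. Hence
  \<open>F(v) = v\<^sub>1\<^sup>p + \<dots> + v\<^sub>N\<^sup>p\<close> is well defined modulo \<open>p\<^sup>2\<close> for a vector \<open>v\<close>
  over \<open>\<Z>\<^sub>p\<close>. In \<open>F(x + y) - F(x) - F(y)\<close> each mixed term is a binomial coefficient divisible by
  \<open>p\<close> times the weight of a monomial of degree \<open>p\<close> in which both \<open>x\<close> and \<open>y\<close> occur. If \<open>x\<close> and \<open>y\<close>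
  are sums of vectors \<open>v(a)\<close> over disjoint sets, that weight vanishes modulo \<open>p\<close> by (o), so \<open>F\<close> is
  additive on them. Finally, \<open>F(i) = N\<close> is \<open>1\<close> modulo \<open>p\<close>, so \<open>N\<^sup>p\<close> is \<open>1\<close> modulo \<open>p\<^sup>2\<close>, and
  \<open>v(a) \<mapsto> N\<^sup>p\<^sup>-\<^sup>1 F(v(a))\<close> is the homomorphism.
\<close>

section \<open>Powers modulo p^2\<close>

text \<open>Each mixed binomial term gets one factor p from the binomial coefficient and the other
  from \<open>mixed\<close>. Divisibility is asked only of the whole sum over \<open>J\<close>,
  which is the form that (o) can provide.\<close>

lemma sum_prime_power_add_cong:
  fixes x y :: "'b \<Rightarrow> int"
  assumes p: "prime p"
    and mixed: "\<And>l. 0 < l \<Longrightarrow> l < p \<Longrightarrow> int p dvd (\<Sum>j\<in>J. x j ^ l * y j ^ (p - l))"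
  shows "[(\<Sum>j\<in>J. (x j + y j) ^ p) = (\<Sum>j\<in>J. x j ^ p) + (\<Sum>j\<in>J. y j ^ p)] (mod int (p\<^sup>2))"
proof -
  have p0: "p > 0" using p prime_gt_0_nat by blast
  have split: "{..p} = insert 0 (insert p {0<..<p})" using p0 by auto
  have "(\<Sum>j\<in>J. (x j + y j) ^ p) = (\<Sum>j\<in>J. \<Sum>l\<le>p. of_nat (p choose l) * x j ^ l * y j ^ (p - l))"
    by (simp add: binomial_ring)
  also have "\<dots> = (\<Sum>l\<le>p. of_nat (p choose l) * (\<Sum>j\<in>J. x j ^ l * y j ^ (p - l)))"
    by (subst sum.swap) (simp add: sum_distrib_left mult.assoc)
  also have "\<dots> = (\<Sum>j\<in>J. x j ^ p) + (\<Sum>j\<in>J. y j ^ p)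
      + (\<Sum>l\<in>{0<..<p}. of_nat (p choose l) * (\<Sum>j\<in>J. x j ^ l * y j ^ (p - l)))"
    unfolding split using p0 by simp
  finally have eq: "(\<Sum>j\<in>J. (x j + y j) ^ p) = (\<Sum>j\<in>J. x j ^ p) + (\<Sum>j\<in>J. y j ^ p)
      + (\<Sum>l\<in>{0<..<p}. of_nat (p choose l) * (\<Sum>j\<in>J. x j ^ l * y j ^ (p - l)))" .
  have "int (p\<^sup>2) dvd (\<Sum>l\<in>{0<..<p}. of_nat (p choose l) * (\<Sum>j\<in>J. x j ^ l * y j ^ (p - l)))"
  proof (rule dvd_sum)
    fix l assume "l \<in> {0<..<p}"
    then have "p dvd p choose l" "int p dvd (\<Sum>j\<in>J. x j ^ l * y j ^ (p - l))"
      using p mixed by (auto intro!: dvd_choose_prime)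
    then have "int p * int p dvd int (p choose l) * (\<Sum>j\<in>J. x j ^ l * y j ^ (p - l))"
      by (intro mult_dvd_mono) auto
    then show "int (p\<^sup>2) dvd of_nat (p choose l) * (\<Sum>j\<in>J. x j ^ l * y j ^ (p - l))"
      by (simp add: power2_eq_square)
  qed
  then show ?thesis unfolding eq by (simp add: cong_iff_dvd_diff)
qed

lemma prime_power_cong_square:
  fixes a b :: int
  assumes p: "prime p" and "[a = b] (mod int p)"
  shows "[a ^ p = b ^ p] (mod int (p\<^sup>2))"
proof -
  obtain c where c: "a = b + int p * c"
    using assms(2) by (metis cong_iff_lin cong_sym)
  have "[(b + int p * c) ^ p = b ^ p + (int p * c) ^ p] (mod int (p\<^sup>2))"
    \<comment> \<open>With a one-element index set this is the case of a single power;
      \<open>mixed\<close> holds because p - l > 0 leaves a factor p in the power of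
      \<open>int p * c\<close>.\<close>
    using sum_prime_power_add_cong[OF p, where J = "{()}" and x = "\<lambda>_. b" and y = "\<lambda>_. int p * c"]
    by (simp add: power_mult_distrib dvd_power)
  moreover have "p \<ge> 2" using p prime_ge_2_nat by blast
  then have "[(int p * c) ^ p = 0] (mod int (p\<^sup>2))"
    by (simp add: cong_0_iff power_mult_distrib le_imp_power_dvd)
  ultimately show ?thesis
    unfolding c by (metis cong_add_lcancel_0 cong_trans cong_add cong_refl add.right_neutral)
qed

section \<open>From residue ring operations to integer arithmetic\<close>

lemma (in residues) finsum_eq_sum_mod:
  assumes "finite A" "f \<in> A \<rightarrow> carrier R"
  shows "(\<Oplus>a\<in>A. f a) = (\<Sum>a\<in>A. f a) mod m"
  using assms
  by (induction A) (auto simp: zero_cong res_add_eq Pi_def mod_simps)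

lemma (in residues) finprod_eq_prod_mod:
  assumes "finite A" "f \<in> A \<rightarrow> carrier R"
  shows "(\<Otimes>a\<in>A. f a) = (\<Prod>a\<in>A. f a) mod m"
  using assms
  by (induction A) (auto simp: one_cong res_mult_eq Pi_def mod_simps)

lemma (in cring) coord_space_finsum_apply:
  assumes "finite A" "f \<in> A \<rightarrow> carrier (coord_space R N)" "j < N"
  shows "(\<Oplus>\<^bsub>coord_space R N\<^esub> a\<in>A. f a) j = (\<Oplus>a\<in>A. f a j)"
proof -
  interpret M: algebra R "coord_space R N"
    by (rule algebra_coord_space) unfold_locales
  have "h j \<in> carrier R" if "h \<in> carrier (coord_space R N)" for h
    using that assms(3) by (auto simp: coord_space_simps)
  with assms show ?thesis
    by (induction A) (auto simp: coord_space_simps(4,5) Pi_def)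
qed

lemma (in cring) coord_space_finprod_apply:
  assumes "finite A" "f \<in> A \<rightarrow> carrier (coord_space R N)" "j < N"
  shows "(\<Otimes>\<^bsub>coord_space R N\<^esub> a\<in>A. f a) j = (\<Otimes>a\<in>A. f a j)"
proof -
  interpret M: algebra R "coord_space R N"
    by (rule algebra_coord_space) unfold_locales
  have "h j \<in> carrier R" if "h \<in> carrier (coord_space R N)" for h
    using that assms(3) by (auto simp: coord_space_simps)
  with assms show ?thesis
    by (induction A) (auto simp: coord_space_simps(2,3) Pi_def)
qed

text \<open>Entries of vectors are integer representatives, so the axioms become statements about
  ordinary integer sums modulo p. In this form they can feed computations modulo p^2, which the ring
  itself cannot express.\<close>

lemma V_mobjD:
  fixes p k N :: nat
  defines "M \<equiv> coord_space (residue_ring (int p)) N"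
  assumes p: "p > 1" and D: "finite D" and mem: "(N, V, i, v) \<in> V_mobj k p D"
  shows "\<And>A. A \<subseteq> D \<Longrightarrow> (\<Oplus>\<^bsub>M\<^esub> a\<in>A. v a) \<in> V"
    and "\<And>A j. A \<subseteq> D \<Longrightarrow> j < N \<Longrightarrow> (\<Oplus>\<^bsub>M\<^esub> a\<in>A. v a) j = (\<Sum>a\<in>A. v a j) mod int p"
    and "\<And>a. a \<in> D \<Longrightarrow> v a \<in> V"
    and "\<And>j. j < N \<Longrightarrow> (\<Sum>a\<in>D. v a j) mod int p = 1"
    and "int N mod int p = 1"
    and "\<And>a b u. a \<in> D \<Longrightarrow> b \<in> D \<Longrightarrow> a \<noteq> b \<Longrightarrow> u \<in> {..<k-2} \<rightarrow> V \<Longrightarrow>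
           int p dvd (\<Sum>j<N. v a j * v b j * (\<Prod>l<k-2. u l j))"
proof -
  define R where "R = residue_ring (int p)"
  interpret residues "int p" R
    by (unfold_locales) (use p in \<open>auto simp: R_def\<close>)
  interpret M: algebra R M
    unfolding M_def R_def[symmetric] by (rule algebra_coord_space) unfold_locales
  have M: "M = coord_space R N" by (simp add: M_def R_def)
  from mem have sub: "submodule V R M" and v: "v \<in> D \<rightarrow>\<^sub>E V"
    and i1: "i = \<one>\<^bsub>M\<^esub>" and w1: "weight R N i = \<one>\<^bsub>R\<^esub>" and s: "(\<Oplus>\<^bsub>M\<^esub> a\<in>D. v a) = i"
    and o: "\<And>a b u. a \<in> D \<Longrightarrow> b \<in> D \<Longrightarrow> a \<noteq> b \<Longrightarrow> u \<in> {..<k-2} \<rightarrow> V \<Longrightarrow>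
         weight R N (v a \<otimes>\<^bsub>M\<^esub> v b \<otimes>\<^bsub>M\<^esub> (\<Otimes>\<^bsub>M\<^esub> l\<in>{..<k-2}. u l)) = \<zero>\<^bsub>R\<^esub>"
    by (auto simp: V_mobj_def Let_def R_def[symmetric] M)
  have subg: "subgroup V (add_monoid M)" using sub by (rule submodule.axioms)
  have VM: "V \<subseteq> carrier M" using subgroup.subset[OF subg] by simp
  show vV: "v a \<in> V" if "a \<in> D" for a using v that by auto
  show "(\<Oplus>\<^bsub>M\<^esub> a\<in>A. v a) \<in> V" if "A \<subseteq> D" for A
    by (rule M.finsum_mem_subgroup[OF subg]) (use that D vV in \<open>auto intro: finite_subset\<close>)
  have coord: "h j \<in> carrier R" if "h \<in> carrier M" "j < N" for h j
    using that by (auto simp: M coord_space_simps)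
  show sums: "(\<Oplus>\<^bsub>M\<^esub> a\<in>A. v a) j = (\<Sum>a\<in>A. v a j) mod int p" if "A \<subseteq> D" "j < N" for A j
  proof -
    have A: "finite A" using that D finite_subset by blast
    have "(\<Oplus>\<^bsub>M\<^esub> a\<in>A. v a) j = (\<Oplus>\<^bsub>R\<^esub>a\<in>A. v a j)"
      unfolding M by (rule coord_space_finsum_apply) (use A that vV VM M in auto)
    also have "\<dots> = (\<Sum>a\<in>A. v a j) mod int p"
      by (rule finsum_eq_sum_mod[OF A]) (use that vV VM in \<open>auto intro!: coord\<close>)
    finally show ?thesis .
  qed
  have ij: "i j = 1" if "j < N" for j
  proof -
    have "i j = 1 mod int p" using that by (simp add: i1 M coord_space_simps one_cong)
    then show ?thesis using p by simp
  qed
  show "(\<Sum>a\<in>D. v a j) mod int p = 1" if "j < N" for j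
    using sums[of D j] ij[OF that] that by (simp add: s)
  \<comment> \<open>All entries of \<open>i\<close> are 1, so its weight is the residue of the
    dimension \<open>N\<close>.\<close>
  have "(\<Oplus>\<^bsub>R\<^esub>j\<in>{..<N}. i j) = (\<Sum>j<N. i j) mod int p"
    by (rule finsum_eq_sum_mod) (use ij p in \<open>auto simp: res_carrier_eq\<close>)
  with w1 ij p show "int N mod int p = 1"
    by (simp add: weight_def one_cong)
  show "int p dvd (\<Sum>j<N. v a j * v b j * (\<Prod>l<k-2. u l j))"
    if ab: "a \<in> D" "b \<in> D" "a \<noteq> b" and u: "u \<in> {..<k-2} \<rightarrow> V" for a b u
  proof -
    let ?w = "v a \<otimes>\<^bsub>M\<^esub> v b \<otimes>\<^bsub>M\<^esub> (\<Otimes>\<^bsub>M\<^esub> l\<in>{..<k-2}. u l)"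
    have uM: "u \<in> {..<k-2} \<rightarrow> carrier M" using u VM by auto
    have w: "?w \<in> carrier M"
      using ab uM vV VM by (intro M.m_closed M.finprod_closed) auto
    have wj: "?w j = (v a j * v b j * (\<Prod>l<k-2. u l j)) mod int p" if "j < N" for j
    proof -
      have "(\<Otimes>\<^bsub>M\<^esub> l\<in>{..<k-2}. u l) j = (\<Otimes>\<^bsub>R\<^esub> l\<in>{..<k-2}. u l j)"
        unfolding M by (rule coord_space_finprod_apply) (use uM M that in auto)
      also have "\<dots> = (\<Prod>l<k-2. u l j) mod int p"
        by (rule finprod_eq_prod_mod) (use uM that in \<open>auto intro!: coord\<close>)
      finally have "(\<Otimes>\<^bsub>M\<^esub> l\<in>{..<k-2}. u l) j = (\<Prod>l<k-2. u l j) mod int p" .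
      with that show ?thesis
        by (simp add: M coord_space_simps res_mult_eq mod_simps)
    qed
    have "(\<Oplus>\<^bsub>R\<^esub>j\<in>{..<N}. ?w j) = (\<Sum>j<N. ?w j) mod int p"
      by (rule finsum_eq_sum_mod) (use w in \<open>auto intro!: coord\<close>)
    also have "\<dots> = (\<Sum>j<N. v a j * v b j * (\<Prod>l<k-2. u l j)) mod int p"
      by (simp add: wj mod_sum_eq)
    finally show ?thesis
      using o[OF ab u] by (simp add: weight_def zero_cong mod_eq_0_iff_dvd)
  qed
qed

section \<open>Additivity of the power weight\<close>

text \<open>The function F of the introduction, kept as an integer so that it can be read modulo
  p^2.\<close>

definition power_weight :: "nat \<Rightarrow> nat \<Rightarrow> (nat \<Rightarrow> int) \<Rightarrow> int" where
  "power_weight p N x = (\<Sum>j<N. x j ^ p)"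

lemma power_weight_cong:
  assumes "prime p" "\<And>j. j < N \<Longrightarrow> [x j = y j] (mod int p)"
  shows "[power_weight p N x = power_weight p N y] (mod int (p\<^sup>2))"
  unfolding power_weight_def
  by (intro cong_sum prime_power_cong_square assms) simp

text \<open>Induction on \<open>A\<close>, adding one vector \<open>v b\<close> at a time. Every
  mixed monomial in \<open>v b\<close> and the sum over \<open>A\<close> has degree p, so after one
  factor of each is split off, p - 2 factors remain, exactly as many as (o) with k = p
  admits.\<close>

lemma power_weight_additive:
  assumes p: "prime p" and D: "finite D" and mem: "(N, V, i, v) \<in> V_mobj p p D" and "A \<subseteq> D"
  shows "[power_weight p N (\<lambda>j. \<Sum>a\<in>A. v a j) = (\<Sum>a\<in>A. power_weight p N (v a))] (mod int (p\<^sup>2))"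
proof -
  have p1: "p > 1" using p prime_gt_1_nat by blast
  note V = V_mobjD[OF p1 D mem]
  have "finite A" using assms finite_subset by blast
  then show ?thesis
    using \<open>A \<subseteq> D\<close>
  proof (induction A)
    case empty
    show ?case using p1 by (simp add: power_weight_def zero_power)
  next
    case (insert b A)
    \<comment> \<open>The sum is taken in the coordinate space, not over the integers:
      \<open>y\<close> then lies in \<open>V\<close> and may be one of the vectors u in (o).\<close>
    define y where "y = (\<Oplus>\<^bsub>coord_space (residue_ring (int p)) N\<^esub> a\<in>A. v a)"
    have yV: "y \<in> V" and y: "\<And>j. j < N \<Longrightarrow> y j = (\<Sum>a\<in>A. v a j) mod int p"
      unfolding y_def using V(1,2)[of A] insert.prems by auto
    have mixed: "int p dvd (\<Sum>j<N. v b j ^ l * y j ^ (p - l))" if l: "0 < l" "l < p" for l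
    proof -
      \<comment> \<open>The factors left over: l - 1 copies of \<open>v b\<close> and p - l - 1
        copies of \<open>y\<close>.\<close>
      define u where "u = (\<lambda>n. if n < l - 1 then v b else y)"
      have u: "u \<in> {..<p-2} \<rightarrow> V" using yV V(3) insert.prems by (auto simp: u_def)
      have uj: "(\<Prod>n<p-2. u n j) = v b j ^ (l - 1) * y j ^ (p - l - 1)" for j
      proof -
        have "(\<Prod>n<p-2. u n j) = (\<Prod>n\<in>{..<l-1} \<union> {l-1..<p-2}. u n j)"
          by (rule prod.cong) (use l in auto)
        also have "\<dots> = (\<Prod>n\<in>{..<l-1}. u n j) * (\<Prod>n\<in>{l-1..<p-2}. u n j)"
          by (rule prod.union_disjoint) auto
        also have "\<dots> = v b j ^ (l - 1) * y j ^ (p - 2 - (l - 1))"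
          by (simp add: u_def)
        also have "p - 2 - (l - 1) = p - l - 1" using l by simp
        finally show ?thesis .
      qed
      \<comment> \<open>Only one factor \<open>y\<close> is expanded into the vectors
        \<open>v a\<close>; the others stay intact as entries of \<open>u\<close>.\<close>
      have "[(\<Sum>j<N. v b j ^ l * y j ^ (p - l))
          = (\<Sum>j<N. v b j * (\<Sum>a\<in>A. v a j) * (v b j ^ (l - 1) * y j ^ (p - l - 1)))] (mod int p)"
      proof (rule cong_sum)
        fix j assume "j \<in> {..<N}"
        then have "[y j = (\<Sum>a\<in>A. v a j)] (mod int p)" by (simp add: y)
        then have "[v b j * y j * (v b j ^ (l - 1) * y j ^ (p - l - 1))
            = v b j * (\<Sum>a\<in>A. v a j) * (v b j ^ (l - 1) * y j ^ (p - l - 1))] (mod int p)"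
          by (intro cong_mult cong_refl)
        moreover have "v b j ^ l = v b j * v b j ^ (l - 1)"
          "y j ^ (p - l) = y j * y j ^ (p - l - 1)"
          using l power_minus_mult[of l "v b j"] power_minus_mult[of "p - l" "y j"]
          by (simp_all add: mult.commute)
        ultimately show "[v b j ^ l * y j ^ (p - l)
            = v b j * (\<Sum>a\<in>A. v a j) * (v b j ^ (l - 1) * y j ^ (p - l - 1))] (mod int p)"
          by (simp add: mult_ac)
      qed
      \<comment> \<open>Exchanging the sums leaves one instance of (o) for each \<open>a\<close> in
        \<open>A\<close>, where \<open>a\<close> differs from \<open>b\<close> because
        \<open>b\<close> is not in \<open>A\<close>.\<close>
      also have "(\<Sum>j<N. v b j * (\<Sum>a\<in>A. v a j) * (v b j ^ (l - 1) * y j ^ (p - l - 1)))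
          = (\<Sum>a\<in>A. \<Sum>j<N. v b j * v a j * (\<Prod>n<p-2. u n j))"
        unfolding uj by (subst sum.swap) (simp add: sum_distrib_left sum_distrib_right)
      also have "[\<dots> = 0] (mod int p)"
        unfolding cong_0_iff by (intro dvd_sum V(6)[OF _ _ _ u]) (use insert in auto)
      finally show ?thesis by (simp add: cong_0_iff)
    qed
    have "[power_weight p N (\<lambda>j. \<Sum>a\<in>insert b A. v a j)
        = power_weight p N (\<lambda>j. v b j + y j)] (mod int (p\<^sup>2))"
      by (rule power_weight_cong[OF p])
        (use insert y in \<open>auto simp: cong_def mod_simps\<close>)
    also have "[power_weight p N (\<lambda>j. v b j + y j)
        = power_weight p N (v b) + power_weight p N y] (mod int (p\<^sup>2))"
      unfolding power_weight_def by (rule sum_prime_power_add_cong[OF p mixed])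
    also have "[power_weight p N (v b) + power_weight p N y
        = power_weight p N (v b) + (\<Sum>a\<in>A. power_weight p N (v a))] (mod int (p\<^sup>2))"
    proof (intro cong_add cong_refl)
      have "[power_weight p N y = power_weight p N (\<lambda>j. \<Sum>a\<in>A. v a j)] (mod int (p\<^sup>2))"
        by (rule power_weight_cong[OF p]) (simp add: y)
      also have "[power_weight p N (\<lambda>j. \<Sum>a\<in>A. v a j) = (\<Sum>a\<in>A. power_weight p N (v a))]
          (mod int (p\<^sup>2))"
        using insert by auto
      finally show "[power_weight p N y = (\<Sum>a\<in>A. power_weight p N (v a))] (mod int (p\<^sup>2))" .
    qed
    finally show ?case
      using insert.hyps by simp
  qed
qed

section \<open>The homomorphism\<close>

text \<open>The factor \<open>int N ^ (p - 1)\<close> is an inverse of \<open>int N\<close> modulo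
  p^2, since \<open>N\<close> is 1 modulo p; it normalises the total to 1.\<close>

definition V_to_Z :: "nat \<Rightarrow> 'a set \<Rightarrow> 'a vel \<Rightarrow> 'a \<Rightarrow> int" where
  "V_to_Z p D = (\<lambda>(N, V, i, v). \<lambda>a\<in>D. int N ^ (p - 1) * power_weight p N (v a) mod int (p\<^sup>2))"

lemma minion_hom_V_to_Z:
  fixes p :: nat
  assumes p: "prime p"
  shows "minion_hom (V_minion p p) (Z_minion (p\<^sup>2)) (V_to_Z p)"
proof -
  have p1: "p > 1" using p prime_gt_1_nat by blast
  then have m1: "p\<^sup>2 > 1" by (intro one_less_power) auto
  interpret V: minion "V_minion p p" by (rule minion_V_minion[OF p1])
  interpret Z: minion "Z_minion (p\<^sup>2)" by (rule minion_Z_minion[OF m1])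
  define R where "R = residue_ring (int (p\<^sup>2))"
  interpret residues "int (p\<^sup>2)" R
    by unfold_locales (use p1 one_less_power[of "int p" 2] in \<open>simp_all add: R_def\<close>)
  have range: "V_to_Z p D x a \<in> carrier R" if "a \<in> D" for D a and x :: "'a vel"
    using that p1 by (auto simp: V_to_Z_def res_carrier_eq split: prod.splits)
  \<comment> \<open>Needed for two choices of \<open>A\<close>: the whole of \<open>D\<close> for
    the total 1, and the fibres of \<alpha> for naturality.\<close>
  have sums: "(\<Oplus>\<^bsub>R\<^esub>a\<in>A. V_to_Z p D (N, V, i, v) a)
      = int N ^ (p - 1) * power_weight p N (\<lambda>j. \<Sum>a\<in>A. v a j) mod int (p\<^sup>2)"
    if D: "finite D" and mem: "(N, V, i, v) \<in> V_mobj p p D" and A: "A \<subseteq> D"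
    for A D N V i and v :: "'a \<Rightarrow> nat \<Rightarrow> int"
  proof -
    have "(\<Oplus>\<^bsub>R\<^esub>a\<in>A. V_to_Z p D (N, V, i, v) a) = (\<Sum>a\<in>A. V_to_Z p D (N, V, i, v) a) mod int (p\<^sup>2)"
      by (rule finsum_eq_sum_mod) (use A D range in \<open>auto intro: finite_subset\<close>)
    also have "(\<Sum>a\<in>A. V_to_Z p D (N, V, i, v) a)
        = (\<Sum>a\<in>A. int N ^ (p - 1) * power_weight p N (v a) mod int (p\<^sup>2))"
      by (rule sum.cong) (use A in \<open>auto simp: V_to_Z_def\<close>)
    also have "\<dots> mod int (p\<^sup>2) = int N ^ (p - 1) * (\<Sum>a\<in>A. power_weight p N (v a)) mod int (p\<^sup>2)"
      by (simp add: mod_sum_eq sum_distrib_left)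
    also have "\<dots> = int N ^ (p - 1) * power_weight p N (\<lambda>j. \<Sum>a\<in>A. v a j) mod int (p\<^sup>2)"
      using cong_mult[OF cong_refl power_weight_additive[OF p D mem A]] unfolding cong_def
      by metis
    finally show ?thesis .
  qed
  show ?thesis
  proof (unfold_locales, goal_cases)
    case (1 D x)
    obtain N V i v where x: "x = (N, V, i, v)" by (metis prod_cases4)
    have mem: "(N, V, i, v) \<in> V_mobj p p D" using 1 by (simp add: x V_minion_def)
    note V = V_mobjD[OF p1 1(1) mem]
    \<comment> \<open>By (s) the vectors add up to the all-ones vector modulo p, whose power weight
      is \<open>N\<close>.\<close>
    have "[power_weight p N (\<lambda>j. \<Sum>a\<in>D. v a j) = power_weight p N (\<lambda>_. 1)] (mod int (p\<^sup>2))"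
      by (rule power_weight_cong[OF p]) (use V(4) p1 in \<open>auto simp: cong_def\<close>)
    then have "[int N ^ (p - 1) * power_weight p N (\<lambda>j. \<Sum>a\<in>D. v a j)
        = int N ^ (p - 1) * int N] (mod int (p\<^sup>2))"
      by (intro cong_mult cong_refl) (simp add: power_weight_def)
    also have "int N ^ (p - 1) * int N = int N ^ p"
      using p1 by (simp flip: power_Suc2)
    also have "[\<dots> = 1 ^ p] (mod int (p\<^sup>2))"
      by (rule prime_power_cong_square[OF p]) (use V(5) p1 in \<open>simp add: cong_def\<close>)
    finally have "(\<Oplus>\<^bsub>R\<^esub>a\<in>D. V_to_Z p D x a) = 1 mod int (p\<^sup>2)"
      unfolding x sums[OF 1(1) mem order_refl] cong_def by simp
    moreover have "V_to_Z p D x \<in> D \<rightarrow>\<^sub>E carrier R"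
      using range by (auto simp: V_to_Z_def x)
    ultimately show ?case
      by (simp add: Z_minion_def R_def)
  next
    case (2 D E \<alpha> x)
    obtain N V i v where x: "x = (N, V, i, v)" by (metis prod_cases4)
    have mem: "(N, V, i, v) \<in> V_mobj p p D" using 2 by (simp add: x V_minion_def)
    note V = V_mobjD[OF p1 2(1) mem]
    let ?F = "\<lambda>b. \<alpha> -` {b} \<inter> D"
    let ?s = "\<lambda>b. \<Oplus>\<^bsub>coord_space (residue_ring (int p)) N\<^esub> a\<in>?F b. v a"
    \<comment> \<open>The vector \<open>?s b\<close> is reduced modulo p while \<open>sums\<close>
      uses the unreduced integer sum; \<open>power_weight_cong\<close> bridges the two modulo
      p^2.\<close>
    have fibre: "int N ^ (p - 1) * power_weight p N (?s b) mod int (p\<^sup>2)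
        = (\<Oplus>\<^bsub>R\<^esub>a\<in>?F b. V_to_Z p D x a)" for b
    proof -
      have "[power_weight p N (?s b) = power_weight p N (\<lambda>j. \<Sum>a\<in>?F b. v a j)] (mod int (p\<^sup>2))"
        by (rule power_weight_cong[OF p]) (simp add: V(2))
      then have "[int N ^ (p - 1) * power_weight p N (?s b)
          = int N ^ (p - 1) * power_weight p N (\<lambda>j. \<Sum>a\<in>?F b. v a j)] (mod int (p\<^sup>2))"
        by (intro cong_mult cong_refl)
      then show ?thesis
        unfolding x using sums[OF 2(1) mem, of "?F b"] by (simp add: cong_def)
    qed
    have "V_to_Z p E (mmap (V_minion p p) D E \<alpha> x) = (\<lambda>b\<in>E. \<Oplus>\<^bsub>R\<^esub>a\<in>?F b. V_to_Z p D x a)"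
      unfolding V_to_Z_def[of p E] fibre[symmetric] by (auto simp: x V_minion_def V_mmap_def)
    then show ?case
      by (simp add: Z_minion_def R_def)
  qed
qed

theorem proposition4p6:
  fixes p :: nat
  assumes "prime p"
  shows "\<exists>\<xi>. minion_hom (V_minion p p :: ('a, 'a vel) minion) (Z_minion (p ^ 2)) \<xi>"
  using minion_hom_V_to_Z[OF assms] by blast

end
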